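(* Let $d\ge1$ and let $\mathbf{V}^{(d)}$ be the $N^d\times L$ $d$-fold random Vandermonde matrix whose phase vectors are i.i.d. in $[0,1]^d$ with a continuous density $f$ satisfying $\min_{[0,1]^d} f>0$. Let $\lambda_L$ be the largest eigenvalue of $(\mathbf{V}^{(d)})^*\mathbf{V}^{(d)}$. If $N,L\to\infty$ with $L/N^d\to\beta\in(0,\infty)$, then there exists a constant $K>0$ such that $$\mathbb{P}\Big(\lambda_L\ge K\,\frac{\log N^d}{\log\log N^d}\Big)=1-o(1).$$
   Context: The $d$-fold Vandermonde matrix: given phase vectors $x_1,\ldots,x_L\in[0,1]^d$ and $N$, index the rows by $\ell\in\{0,\ldots,N-1\}^d$ via $\gamma(\ell)=\sum_{j=1}^d N^{j-1}\ell_j$, and set $\mathbf{V}^{(d)}_{(\gamma(\ell),q)}=N^{-d/2}\exp(2\pi i\langle \ell,x_q\rangle)$. *)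

theory Defs
  imports "HOL-Probability.Probability" "Jordan_Normal_Form.Schur_Decomposition"
begin

text \<open>Phase vectors in [0,1]^d are represented as extensional functions nat => real on {..<d};
  coordinate j (0-based) corresponds to the paper's coordinate j+1.\<close>

definition unit_cube :: "nat \<Rightarrow> (nat \<Rightarrow> real) set" where
  "unit_cube d = PiE {..<d} (\<lambda>_. {0..1})"

definition lebesgue_d :: "nat \<Rightarrow> (nat \<Rightarrow> real) measure" where
  "lebesgue_d d = PiM {..<d} (\<lambda>_. lborel)"

definition phase_distr :: "nat \<Rightarrow> ((nat \<Rightarrow> real) \<Rightarrow> real) \<Rightarrow> (nat \<Rightarrow> real) measure" where
  "phase_distr d f = density (lebesgue_d d) (\<lambda>x. indicator (unit_cube d) x * ennreal (f x))"

definition phases_distr :: "nat \<Rightarrow> ((nat \<Rightarrow> real) \<Rightarrow> real) \<Rightarrow> nat \<Rightarrow> (nat \<Rightarrow> nat \<Rightarrow> real) measure" where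
  "phases_distr d f L = PiM {..<L} (\<lambda>_. phase_distr d f)"

text \<open>The d-fold Vandermonde matrix (N^d x L). Row r = gamma(l) with
  gamma(l) = sum_j N^j l_j (0-based j), i.e. l_j = (r div N^j) mod N.\<close>
definition vandermonde_d :: "nat \<Rightarrow> nat \<Rightarrow> nat \<Rightarrow> (nat \<Rightarrow> nat \<Rightarrow> real) \<Rightarrow> complex mat" where
  "vandermonde_d d N L x = mat (N ^ d) L (\<lambda>(r, q).
      complex_of_real (real N powr (- real d / 2)) *
      exp (2 * pi * \<i> * complex_of_real (\<Sum>j<d. real ((r div N ^ j) mod N) * x q j)))"

definition largest_eigenvalue :: "complex mat \<Rightarrow> real" where
  "largest_eigenvalue A = Max {r :: real. eigenvalue A (complex_of_real r)}"

end

theory Submission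
  imports Defs "Jordan_Normal_Form.Spectral_Radius" "HOL-Real_Asymp.Real_Asymp"
begin

text \<open>If \<open>k\<close> phase vectors lie in a common cube of side \<open>1 / (6 d N)\<close>, then the corresponding columns
  hardly cancel when added, and the Rayleigh quotient of their sum is at least \<open>k / 4\<close>. So it suffices
  that some cube catches \<open>k = \<kappa> ln D / ln ln D\<close> of the points, where \<open>D = N^d\<close>. About \<open>sqrt N\<close>
  disjoint cubes, each of probability of order \<open>1 / D\<close>, are examined one after the other: as long as
  every cube seen so far caught fewer than \<open>k\<close> points, at least half of the points are still free, and
  the next cube catches \<open>k\<close> of them with conditional probability at least
  \<open>(c / k)^k\<close> up to a constant, which exceeds \<open>N^(-1/4)\<close> if \<open>\<kappa> = 1 / (16 d)\<close>. All cubes fail with probability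
  at most \<open>exp (- c' N^(1/4))\<close>. The measure of a non-measurable set is \<open>0\<close> by convention, so
  measurability of the event is an essential part of the claim.\<close>

section \<open>The largest eigenvalue of a Gram matrix\<close>

text \<open>The squared Euclidean norm as a real number, so that Rayleigh quotients can be compared
  in the reals rather than through \<open>v \<bullet>c v\<close>.\<close>

definition cvec_sq :: "complex vec \<Rightarrow> real" where
  "cvec_sq v = (\<Sum>i<dim_vec v. (cmod (v $ i))\<^sup>2)"

lemma cvec_sq_nonneg: "0 \<le> cvec_sq v"
  by (simp add: cvec_sq_def sum_nonneg)

lemma cscalar_prod_self: "v \<bullet>c v = complex_of_real (cvec_sq v)"
  unfolding cvec_sq_def scalar_prod_def
  by (auto simp: complex_norm_square atLeast0LessThan simp del: of_real_power)

lemma complex_Cauchy_Schwarz_sum: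
  fixes a b :: "'i \<Rightarrow> complex"
  shows "(cmod (\<Sum>i\<in>S. a i * b i))\<^sup>2 \<le> (\<Sum>i\<in>S. (cmod (a i))\<^sup>2) * (\<Sum>i\<in>S. (cmod (b i))\<^sup>2)"
proof -
  have "cmod (\<Sum>i\<in>S. a i * b i) \<le> (\<Sum>i\<in>S. cmod (a i) * cmod (b i))"
    by (rule order_trans[OF norm_sum]) (simp add: norm_mult)
  then have "(cmod (\<Sum>i\<in>S. a i * b i))\<^sup>2 \<le> (\<Sum>i\<in>S. cmod (a i) * cmod (b i))\<^sup>2"
    by (rule power_mono) simp
  also have "\<dots> \<le> (\<Sum>i\<in>S. (cmod (a i))\<^sup>2) * (\<Sum>i\<in>S. (cmod (b i))\<^sup>2)"
    by (rule Cauchy_Schwarz_ineq_sum)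
  finally show ?thesis .
qed

lemma cscalar_prod_le:
  assumes "dim_vec v = dim_vec w"
  shows "(cmod (v \<bullet>c w))\<^sup>2 \<le> cvec_sq v * cvec_sq w"
  using complex_Cauchy_Schwarz_sum[of "\<lambda>i. v $ i" "\<lambda>i. cnj (w $ i)" "{..<dim_vec w}"] assms
  by (simp add: cvec_sq_def scalar_prod_def atLeast0LessThan)

text \<open>The squared Frobenius norm serves as operator bound, by Cauchy-Schwarz in each row.
  Adding 1 makes the constant positive also for the zero matrix, so that it may be divided by. Used
  for \<open>V\<close> itself and for an inverse of the shifted Gram matrix.\<close>

lemma cvec_sq_mult_bound:
  fixes X :: "complex mat"
  assumes X: "X \<in> carrier_mat m n"
  shows "\<exists>c>0. \<forall>v\<in>carrier_vec n. cvec_sq (X *\<^sub>v v) \<le> c * cvec_sq v"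
proof (intro exI conjI ballI)
  define c where "c = (\<Sum>i<m. \<Sum>j<n. (cmod (X $$ (i,j)))\<^sup>2) + 1"
  show "0 < c" unfolding c_def by (smt (verit) sum_nonneg zero_le_power2)
  fix v :: "complex vec" assume v: "v \<in> carrier_vec n"
  have "cvec_sq (X *\<^sub>v v) = (\<Sum>i<m. (cmod (\<Sum>j<n. X $$ (i,j) * v $ j))\<^sup>2)"
    using X v by (auto simp: cvec_sq_def scalar_prod_def atLeast0LessThan intro!: sum.cong)
  also have "\<dots> \<le> (\<Sum>i<m. (\<Sum>j<n. (cmod (X $$ (i,j)))\<^sup>2) * cvec_sq v)"
    using v by (intro sum_mono order_trans[OF complex_Cauchy_Schwarz_sum]) (auto simp: cvec_sq_def)
  also have "\<dots> \<le> c * cvec_sq v"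
    by (simp add: c_def sum_distrib_right[symmetric] distrib_right cvec_sq_nonneg)
  finally show "cvec_sq (X *\<^sub>v v) \<le> c * cvec_sq v" .
qed

lemma mat_adjoint_carrier: "A \<in> carrier_mat m n \<Longrightarrow> mat_adjoint A \<in> carrier_mat n m"
  by (auto simp: mat_adjoint_def)

lemma mat_adjoint_index:
  fixes A :: "complex mat"
  assumes "A \<in> carrier_mat m n" "i < n" "j < m"
  shows "mat_adjoint A $$ (i,j) = cnj (A $$ (j,i))"
  using assms by (auto simp: mat_adjoint_def mat_of_rows_index)

lemma cscalar_prod_mat_adjoint:
  fixes A :: "complex mat"
  assumes A: "A \<in> carrier_mat m n" and v: "v \<in> carrier_vec n" and w: "w \<in> carrier_vec m"
  shows "(A *\<^sub>v v) \<bullet>c w = v \<bullet>c (mat_adjoint A *\<^sub>v w)"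
proof -
  have B: "mat_adjoint A \<in> carrier_mat n m" by (rule mat_adjoint_carrier[OF A])
  have "(A *\<^sub>v v) \<bullet>c w = (\<Sum>i<m. (\<Sum>j<n. A $$ (i,j) * v $ j) * cnj (w $ i))"
    using A v w by (auto simp: scalar_prod_def atLeast0LessThan intro!: sum.cong)
  also have "\<dots> = (\<Sum>j<n. \<Sum>i<m. A $$ (i,j) * v $ j * cnj (w $ i))"
    by (simp add: sum_distrib_right) (rule sum.swap)
  also have "\<dots> = (\<Sum>j<n. v $ j * cnj (\<Sum>i<m. mat_adjoint A $$ (j,i) * w $ i))"
    using A by (intro sum.cong refl) (simp add: mat_adjoint_index sum_distrib_left mult_ac)
  also have "\<dots> = v \<bullet>c (mat_adjoint A *\<^sub>v w)"
    using B v w by (auto simp: scalar_prod_def atLeast0LessThan intro!: sum.cong)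
  finally show ?thesis .
qed

lemma cvec_sq_diff:
  assumes "dim_vec v = dim_vec w"
  shows "cvec_sq (complex_of_real t \<cdot>\<^sub>v v - w)
    = t\<^sup>2 * cvec_sq v - 2 * t * Re (v \<bullet>c w) + cvec_sq w"
proof -
  have eq: "(cmod (complex_of_real t * x - y))\<^sup>2
      = t\<^sup>2 * (cmod x)\<^sup>2 - 2 * t * Re (x * cnj y) + (cmod y)\<^sup>2" for x y
    by (simp only: cmod_power2) (simp add: power2_eq_square algebra_simps)
  have "cvec_sq (complex_of_real t \<cdot>\<^sub>v v - w)
      = (\<Sum>i<dim_vec w. (cmod (complex_of_real t * v $ i - w $ i))\<^sup>2)"
    using assms by (simp add: cvec_sq_def)
  also have "\<dots> = t\<^sup>2 * cvec_sq v - 2 * t * (\<Sum>i<dim_vec w. Re (v $ i * cnj (w $ i))) + cvec_sq w"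
    using assms unfolding eq
    by (simp add: cvec_sq_def sum.distrib sum_subtractf sum_distrib_left del: times_complex.sel)
  finally show ?thesis
    using assms by (simp add: scalar_prod_def atLeast0LessThan)
qed

text \<open>The least $M$ with $|Vv|^2 \le M |v|^2$ is an eigenvalue of $A = V^* V$: Cauchy--Schwarz gives
  $|Mv - Av|^2 \le M (M |v|^2 - |Vv|^2)$, so an inverse of $M - A$ would make $M$ improvable.\<close>

lemma gram_top_eigenvalue:
  fixes V :: "complex mat"
  assumes V: "V \<in> carrier_mat m n" and v0: "v0 \<in> carrier_vec n" and pos: "cvec_sq (V *\<^sub>v v0) > 0"
  obtains M where "eigenvalue (mat_adjoint V * V) (complex_of_real M)"
    "\<And>v. v \<in> carrier_vec n \<Longrightarrow> cvec_sq (V *\<^sub>v v) \<le> M * cvec_sq v"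
proof -
  define A where "A = mat_adjoint V * V"
  have V': "mat_adjoint V \<in> carrier_mat n m" by (rule mat_adjoint_carrier[OF V])
  have A: "A \<in> carrier_mat n n" unfolding A_def using V V' by simp
  have Av: "A *\<^sub>v v = mat_adjoint V *\<^sub>v (V *\<^sub>v v)" if "v \<in> carrier_vec n" for v
    unfolding A_def by (rule assoc_mult_mat_vec[OF V' V that])
  define S where "S = {c. \<forall>v\<in>carrier_vec n. cvec_sq (V *\<^sub>v v) \<le> c * cvec_sq v}"
  define M where "M = Inf S"
  obtain c0 where c0: "c0 \<in> S"
    using cvec_sq_mult_bound[OF V] unfolding S_def by blast
  have v0pos: "cvec_sq v0 > 0"
  proof (rule ccontr)
    assume "\<not> cvec_sq v0 > 0"
    then have "c0 * cvec_sq v0 = 0" using cvec_sq_nonneg[of v0] by simp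
    with c0 v0 pos show False unfolding S_def by fastforce
  qed
  \<comment> \<open>The Rayleigh quotient of \<open>v0\<close> is a positive lower bound of
    \<open>S\<close>; it makes the infimum \<open>M\<close> positive.\<close>
  define b where "b = cvec_sq (V *\<^sub>v v0) / cvec_sq v0"
  have b: "b > 0" unfolding b_def using pos v0pos by simp
  have lb: "b \<le> c" if "c \<in> S" for c
    using that v0 v0pos unfolding S_def b_def by (auto simp: divide_simps)
  have bdd: "bdd_below S" using lb by (auto simp: bdd_below_def)
  have Mpos: "M > 0"
    using cInf_greatest[of S b] lb b c0 unfolding M_def by fastforce
  have least: "M \<le> c" if "c \<in> S" for c
    unfolding M_def using bdd that by (rule cInf_lower[rotated])
  have bound: "cvec_sq (V *\<^sub>v v) \<le> M * cvec_sq v" if v: "v \<in> carrier_vec n" for v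
  proof (cases "cvec_sq v = 0")
    case True
    with c0 v show ?thesis unfolding S_def by fastforce
  next
    case False
    then have p: "cvec_sq v > 0" using cvec_sq_nonneg[of v] by simp
    have "cvec_sq (V *\<^sub>v v) / cvec_sq v \<le> M" unfolding M_def
      using c0 v p by (intro cInf_greatest) (auto simp: S_def divide_simps)
    then show ?thesis using p by (simp add: divide_simps)
  qed
  have defect: "cvec_sq (complex_of_real M \<cdot>\<^sub>v v - A *\<^sub>v v) \<le> M * (M * cvec_sq v - cvec_sq (V *\<^sub>v v))"
    if v: "v \<in> carrier_vec n" for v
  proof -
    let ?w = "V *\<^sub>v v" let ?u = "A *\<^sub>v v"
    have w: "?w \<in> carrier_vec m" and u: "?u \<in> carrier_vec n" using V A v by auto
    have inner: "v \<bullet>c ?u = complex_of_real (cvec_sq ?w)"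
      unfolding Av[OF v] cscalar_prod_mat_adjoint[OF V v w, symmetric] by (rule cscalar_prod_self)
    \<comment> \<open>Write |Av|^2 as the inner product of V(Av) with Vv. Cauchy-Schwarz and the
      bound \<open>M\<close> at the vector Av give |Av|^4 \<le> M |Av|^2 |Vv|^2, and one factor
      |Av|^2 cancels.\<close>
    have "complex_of_real (cvec_sq ?u) = (V *\<^sub>v ?u) \<bullet>c ?w"
      using cscalar_prod_mat_adjoint[OF V u w] unfolding Av[OF v, symmetric] cscalar_prod_self by simp
    then have "(cvec_sq ?u)\<^sup>2 = (cmod ((V *\<^sub>v ?u) \<bullet>c ?w))\<^sup>2"
      by (metis norm_of_real power2_abs)
    also have "\<dots> \<le> cvec_sq (V *\<^sub>v ?u) * cvec_sq ?w"
      using V by (intro cscalar_prod_le) auto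
    also have "\<dots> \<le> (M * cvec_sq ?u) * cvec_sq ?w"
      by (intro mult_right_mono bound u cvec_sq_nonneg)
    finally have "cvec_sq ?u * cvec_sq ?u \<le> cvec_sq ?u * (M * cvec_sq ?w)"
      by (simp add: power2_eq_square mult_ac)
    then have "cvec_sq ?u \<le> M * cvec_sq ?w"
      using cvec_sq_nonneg[of ?u] cvec_sq_nonneg[of ?w] Mpos
      by (cases "cvec_sq ?u = 0") (auto simp: mult_le_cancel_left)
    then show ?thesis
      using v u A by (subst cvec_sq_diff) (auto simp: inner power2_eq_square algebra_simps)
  qed
  have "eigenvalue A (complex_of_real M)"
  proof (rule ccontr)
    assume neg: "\<not> ?thesis"
    define B where "B = char_matrix A (complex_of_real M)"
    have B: "B \<in> carrier_mat n n" unfolding B_def using A by auto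
    have "det B \<noteq> 0" using neg eigenvalue_det[OF A] unfolding B_def by simp
    then obtain C where C: "C \<in> carrier_mat n n" "C * B = 1\<^sub>m n"
      using det_non_zero_imp_unit[OF B] B unfolding Units_def ring_mat_def by auto
    obtain c where c: "c > 0" "\<And>v. v \<in> carrier_vec n \<Longrightarrow> cvec_sq (C *\<^sub>v v) \<le> c * cvec_sq v"
      using cvec_sq_mult_bound[OF C(1)] by blast
    \<comment> \<open>From |v|^2 = |CBv|^2 \<le> c |Bv|^2 and the defect bound, |v|^2 \<le> cM (M
      |v|^2 - |Vv|^2). Solving for |Vv|^2 yields the constant M - 1/(cM), which is smaller than the
      infimum.\<close>
    have "M - 1 / (c * M) \<in> S" unfolding S_def
    proof (intro CollectI ballI)
      fix v :: "complex vec" assume v: "v \<in> carrier_vec n"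
      have Bv: "B *\<^sub>v v = A *\<^sub>v v - complex_of_real M \<cdot>\<^sub>v v"
      proof (intro eq_vecI)
        fix i assume "i < dim_vec (A *\<^sub>v v - complex_of_real M \<cdot>\<^sub>v v)"
        then have i: "i < n" using v by simp
        have "(B *\<^sub>v v) $ i = (\<Sum>j<n. (A $$ (i,j) - (if i = j then complex_of_real M else 0)) * v $ j)"
          using A B v i unfolding B_def char_matrix_def 
          by (auto simp: scalar_prod_def atLeast0LessThan intro!: sum.cong)
        also have "\<dots> = (\<Sum>j<n. A $$ (i,j) * v $ j) - complex_of_real M * v $ i"
          using i by (simp add: left_diff_distrib sum_subtractf if_distrib[of "\<lambda>x. x * _"] sum.delta cong: if_cong)
        finally show "(B *\<^sub>v v) $ i = (A *\<^sub>v v - complex_of_real M \<cdot>\<^sub>v v) $ i"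
          using A v i by (simp add: scalar_prod_def atLeast0LessThan)
      qed (use A B v in auto)
      have "cvec_sq v = cvec_sq (C *\<^sub>v (B *\<^sub>v v))"
        using assoc_mult_mat_vec[OF C(1) B v] C(2) v by simp
      also have "\<dots> \<le> c * cvec_sq (B *\<^sub>v v)" using B v by (intro c(2)) auto
      also have "cvec_sq (B *\<^sub>v v) = cvec_sq (complex_of_real M \<cdot>\<^sub>v v - A *\<^sub>v v)"
        unfolding Bv cvec_sq_def using A v by (auto simp: norm_minus_commute)
      also have "\<dots> \<le> M * (M * cvec_sq v - cvec_sq (V *\<^sub>v v))" by (rule defect[OF v])
      finally have "cvec_sq v \<le> (c * M) * (M * cvec_sq v - cvec_sq (V *\<^sub>v v))"
        using c(1) by (simp add: mult_ac)
      then have "cvec_sq v / (c * M) \<le> M * cvec_sq v - cvec_sq (V *\<^sub>v v)"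
        using c(1) Mpos by (simp add: pos_divide_le_eq mult_ac)
      then show "cvec_sq (V *\<^sub>v v) \<le> (M - 1 / (c * M)) * cvec_sq v"
        by (simp add: algebra_simps)
    qed
    from least[OF this] have "1 / (c * M) \<le> 0" by simp
    moreover have "1 / (c * M) > 0" using c(1) Mpos by simp
    ultimately show False by linarith
  qed
  then show thesis using that bound unfolding A_def by blast
qed

lemma finite_real_eigenvalues:
  assumes "A \<in> carrier_mat n n"
  shows "finite {r :: real. eigenvalue A (complex_of_real r)}"
  using finite_vimageI[OF card_finite_spectrum(1)[OF assms], of complex_of_real]
  by (simp add: spectrum_def vimage_def inj_of_real)

text \<open>\<open>Max\<close> needs a finite nonempty set: the spectrum is finite, and the top
  eigenvalue just constructed shows that a real one exists. The equivalence prepares the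
  measurability proof; the second claim is the Rayleigh bound for the clusters.\<close>

lemma
  fixes V :: "complex mat"
  assumes V: "V \<in> carrier_mat m n" and v0: "v0 \<in> carrier_vec n" and pos: "cvec_sq (V *\<^sub>v v0) > 0"
  shows largest_eigenvalue_gram_ge_iff: "c \<le> largest_eigenvalue (mat_adjoint V * V) \<longleftrightarrow>
      (\<exists>r\<ge>c. eigenvalue (mat_adjoint V * V) (complex_of_real r))" (is ?iff)
    and cvec_sq_le_largest_eigenvalue_gram: "v \<in> carrier_vec n \<Longrightarrow>
      cvec_sq (V *\<^sub>v v) \<le> largest_eigenvalue (mat_adjoint V * V) * cvec_sq v"
proof -
  let ?A = "mat_adjoint V * V"
  have A: "?A \<in> carrier_mat n n" using V mat_adjoint_carrier[OF V] by simp
  obtain M where M: "eigenvalue ?A (complex_of_real M)"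
      "\<And>v. v \<in> carrier_vec n \<Longrightarrow> cvec_sq (V *\<^sub>v v) \<le> M * cvec_sq v"
    using gram_top_eigenvalue[OF V v0 pos] by metis
  show ?iff
    unfolding largest_eigenvalue_def using M(1) finite_real_eigenvalues[OF A]
    by (subst Max_ge_iff) auto
  have "M \<le> largest_eigenvalue ?A"
    unfolding largest_eigenvalue_def using M(1) finite_real_eigenvalues[OF A] by simp
  then show "cvec_sq (V *\<^sub>v v) \<le> largest_eigenvalue ?A * cvec_sq v" if "v \<in> carrier_vec n"
    by (rule order_trans[OF M(2)[OF that] mult_right_mono[OF _ cvec_sq_nonneg]])
qed

section \<open>Measurability of eigenvalue events\<close>

text \<open>Replaces a quantifier over reals by countable ones. On a compact segment from
  \<open>c\<close> to \<open>c + R\<close> a nonnegative continuous function attains its infimum,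
  and values close to 0 are already found at rational parameters. Fixing \<open>R\<close> before
  \<open>k\<close> excludes functions that only tend to 0 at infinity; the clamp keeps every
  rational parameter inside the segment.\<close>

lemma root_in_closed_ray_iff:
  fixes g :: "real \<Rightarrow> real"
  assumes cont: "continuous_on UNIV g" and nonneg: "\<And>r. 0 \<le> g r"
  shows "(\<exists>r\<ge>c. g r = 0) \<longleftrightarrow>
    (\<exists>R::nat. \<forall>k::nat. \<exists>t::rat. g (c + real R * min 1 (max 0 (of_rat t))) < 1 / real (Suc k))"
proof -
  define h where "h R t = g (c + real R * min 1 (max 0 t))" for R :: nat and t
  have h: "continuous_on UNIV (h R)" for R
    unfolding h_def by (rule continuous_on_compose2[OF cont]) (auto intro!: continuous_intros)
  show ?thesis unfolding h_def[symmetric]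
  proof
    assume "\<exists>r\<ge>c. g r = 0"
    then obtain r where r: "r \<ge> c" "g r = 0" by blast
    obtain R :: nat where "R > r - c" using reals_Archimedean2 by blast
    then have R: "real R > 0" "r - c \<le> R" using r by auto
    define t where "t = (r - c) / R"
    have "h R t = 0" using r R by (simp add: h_def t_def)
    show "\<exists>R. \<forall>k. \<exists>t. h R (of_rat t) < 1 / real (Suc k)"
    proof (intro exI[of _ R] allI)
      fix k
      have "isCont (h R) t" using h[of R] by (simp add: continuous_on_eq_continuous_at)
      then have "\<forall>\<^sub>F s in at t. h R s < 1 / real (Suc k)"
        using order_tendstoD(2)[of "h R" "h R t" "at t" "1 / real (Suc k)"] \<open>h R t = 0\<close>
        by (simp add: isCont_def)
      then obtain e where e: "e > 0" "\<And>s. s \<noteq> t \<Longrightarrow> dist s t < e \<Longrightarrow> h R s < 1 / real (Suc k)"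
        unfolding eventually_at by auto
      \<comment> \<open>The rational lies strictly to the right of \<open>t\<close>, hence in the
        punctured neighbourhood. It may exceed 1, which is harmless because the clamped
        \<open>h R\<close> is continuous on the whole line.\<close>
      obtain s where s: "t < of_rat s" "of_rat s < t + e"
        using of_rat_dense[of t "t + e"] e(1) by auto
      then have "h R (of_rat s) < 1 / real (Suc k)" by (intro e(2)) (auto simp: dist_real_def)
      then show "\<exists>s. h R (of_rat s) < 1 / real (Suc k)" by blast
    qed
  next
    assume "\<exists>R. \<forall>k. \<exists>t. h R (of_rat t) < 1 / real (Suc k)"
    then obtain R where R: "\<And>k. \<exists>t. h R (of_rat t) < 1 / real (Suc k)" by blast
    have "continuous_on {0..1} (h R)" using h[of R] by (rule continuous_on_subset) simp
    then obtain t where t: "t \<in> {0..1}" "\<And>s. s \<in> {0..1} \<Longrightarrow> h R t \<le> h R s"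
      using continuous_attains_inf[of "{0..1}" "h R"] by auto
    have clamp: "h R (min 1 (max 0 s)) = h R s" for s
      by (simp add: h_def)
    have "h R t \<le> 1 / real (Suc k)" for k
    proof -
      obtain s where "h R (of_rat s) < 1 / real (Suc k)" using R by blast
      then show ?thesis using t(2)[of "min 1 (max 0 (of_rat s))"] clamp[of "of_rat s"] by simp
    qed
    then have "h R t \<le> 0"
      by (metis not_le reals_Archimedean inverse_eq_divide)
    then have "g (c + real R * min 1 (max 0 t)) = 0" using nonneg by (simp add: h_def antisym)
    then show "\<exists>r\<ge>c. g r = 0" using t(1) by (intro exI[of _ "c + real R * min 1 (max 0 t)"]) auto
  qed
qed

text \<open>Eigenvalues are the zeros of the modulus \<open>g x r\<close> of the characteristic
  determinant. By the Leibniz formula this is continuous in \<open>r\<close> and, for fixed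
  \<open>r\<close>, measurable in \<open>x\<close>, so the countable description of roots
  applies.\<close>

lemma measurable_ex_eigenvalue_ge:
  fixes A :: "'a \<Rightarrow> complex mat"
  assumes A: "\<And>x. A x \<in> carrier_mat n n"
    and meas: "\<And>i j. i < n \<Longrightarrow> j < n \<Longrightarrow> (\<lambda>x. A x $$ (i,j)) \<in> borel_measurable M"
  shows "{x \<in> space M. \<exists>r\<ge>c. eigenvalue (A x) (complex_of_real r)} \<in> sets M"
proof -
  define g where "g x r = cmod (\<Sum>p | p permutes {0..<n}. signof p *
      (\<Prod>i = 0..<n. A x $$ (i, p i) - complex_of_real r * (if i = p i then 1 else 0)))" for x and r :: real
  have ev: "eigenvalue (A x) (complex_of_real r) \<longleftrightarrow> g x r = 0" for x r
  proof -
    have C: "char_matrix (A x) (complex_of_real r) \<in> carrier_mat n n" using A[of x] by simp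
    have "det (char_matrix (A x) (complex_of_real r)) = (\<Sum>p | p permutes {0..<n}. signof p *
      (\<Prod>i = 0..<n. A x $$ (i, p i) - complex_of_real r * (if i = p i then 1 else 0)))"
      unfolding det_def'[OF C]
    proof (intro sum.cong refl arg_cong2[where f = "(*)"] prod.cong)
      fix p i assume "p \<in> {p. p permutes {0..<n}}" "i \<in> {0..<n}"
      then have "i < n" "p i < n" using permutes_in_image[of p "{0..<n}" i] by auto
      then show "char_matrix (A x) (complex_of_real r) $$ (i, p i)
          = A x $$ (i, p i) - complex_of_real r * (if i = p i then 1 else 0)"
        using A[of x] by (simp add: char_matrix_def)
    qed
    then show ?thesis by (simp add: eigenvalue_det[OF A] g_def)
  qed
  have cont: "continuous_on UNIV (g x)" for x
    unfolding g_def by (intro continuous_intros)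
  have nonneg: "0 \<le> g x r" for x r
    by (simp add: g_def)
  have [measurable]: "(\<lambda>x. g x r) \<in> borel_measurable M" for r
    unfolding g_def
    by (intro measurable_compose[OF _ borel_measurable_norm] borel_measurable_sum borel_measurable_times
          borel_measurable_prod borel_measurable_diff borel_measurable_const meas)
       (auto simp: permutes_in_image[of _ "{0..<n}", unfolded atLeastLessThan_iff])
  show ?thesis
    unfolding ev root_in_closed_ray_iff[OF cont nonneg] by measurable
qed

section \<open>Maximal load of disjoint bins\<close>

text \<open>By the binomial theorem the sum over all \<open>T\<close> is (w + p)^|A|; dropping the
  sets of size exactly \<open>k\<close> already saves (|A| choose k) p^k w^(|A| - k). With W = w + p
  between 1/2 and 1, this saving is compared with W^|A| through p \<ge> W p0 and w \<ge> W (1 - 2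
  p1). The bounds \<open>n0\<close> and \<open>L\<close> on |A| make the relative saving independent
  of \<open>A\<close>.\<close>

lemma binomial_lower_tail_le:
  fixes p w p0 p1 :: real
  assumes A: "finite A" "card A \<le> L" "n0 \<le> card A" 
    and p: "0 \<le> p0" "p0 \<le> p" "p \<le> p1" "2 * p1 \<le> 1" and w: "1 / 2 \<le> w" "w + p \<le> 1"
  shows "(\<Sum>T | T \<subseteq> A \<and> card T < k. p ^ card T * w ^ card (A - T))
    \<le> (w + p) ^ card A * (1 - real (n0 choose k) * p0 ^ k * (1 - 2 * p1) ^ L)"
proof -
  let ?W = "w + p" let ?n = "card A"
  let ?g = "\<lambda>T. p ^ card T * w ^ card (A - T)"
  have W: "1 / 2 \<le> ?W" using p w by linarith
  have "?W ^ ?n = (\<Sum>T\<in>Pow A. ?g T)"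
    using prod_add[OF A(1), of "\<lambda>_. p" "\<lambda>_. w"] by (simp add: add.commute)
  also have "\<dots> \<ge> (\<Sum>T\<in>{T. T \<subseteq> A \<and> card T < k} \<union> {T. T \<subseteq> A \<and> card T = k}. ?g T)"
    using A p w by (intro sum_mono2) auto
  also have "(\<Sum>T\<in>{T. T \<subseteq> A \<and> card T < k} \<union> {T. T \<subseteq> A \<and> card T = k}. ?g T)
     = (\<Sum>T | T \<subseteq> A \<and> card T < k. ?g T) + (\<Sum>T | T \<subseteq> A \<and> card T = k. ?g T)"
    using A(1) by (intro sum.union_disjoint) (auto intro: finite_subset[of _ "Pow A"])
  also have "(\<Sum>T | T \<subseteq> A \<and> card T = k. ?g T) = (\<Sum>T | T \<subseteq> A \<and> card T = k. p ^ k * w ^ (?n - k))"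
    using A(1) by (intro sum.cong refl) (auto simp: card_Diff_subset finite_subset)
  also have "\<dots> = real (?n choose k) * (p ^ k * w ^ (?n - k))"
    by (simp add: n_subsets[OF A(1)])
  finally have split: "(\<Sum>T | T \<subseteq> A \<and> card T < k. ?g T)
      \<le> ?W ^ ?n - real (?n choose k) * (p ^ k * w ^ (?n - k))" by linarith
  have "?W ^ ?n * (real (n0 choose k) * p0 ^ k * (1 - 2 * p1) ^ L)
      \<le> real (?n choose k) * (p ^ k * w ^ (?n - k))"
  proof (cases "k \<le> ?n")
    case True
    have "(?W * p0) ^ k \<le> p ^ k"
      using p w W mult_right_mono[of ?W 1 p0] by (intro power_mono) auto
    moreover have "?W ^ (?n - k) * (1 - 2 * p1) ^ L \<le> w ^ (?n - k)"
    proof -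
      have "(1 - 2 * p1) ^ L \<le> (1 - 2 * p1) ^ (?n - k)"
        using A p by (intro power_decreasing) auto
      then have "?W ^ (?n - k) * (1 - 2 * p1) ^ L \<le> (?W * (1 - 2 * p1)) ^ (?n - k)"
        using W by (simp add: power_mult_distrib mult_left_mono)
      also have "p \<le> ?W * (2 * p1)"
        using mult_right_mono[OF W, of "2 * p1"] p by linarith
      then have "(?W * (1 - 2 * p1)) ^ (?n - k) \<le> w ^ (?n - k)"
        using p W by (intro power_mono mult_nonneg_nonneg) (auto simp: algebra_simps)
      finally show ?thesis .
    qed
    ultimately have "(?W * p0) ^ k * (?W ^ (?n - k) * (1 - 2 * p1) ^ L) \<le> p ^ k * w ^ (?n - k)"
      using p w W by (intro mult_mono) auto
    moreover have "real (n0 choose k) \<le> real (?n choose k)"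
      using A(3) by (simp add: binomial_right_mono)
    ultimately have "real (n0 choose k) * ((?W * p0) ^ k * (?W ^ (?n - k) * (1 - 2 * p1) ^ L))
       \<le> real (?n choose k) * (p ^ k * w ^ (?n - k))"
      using p w W by (intro mult_mono[of "real (n0 choose k)"]) auto
    moreover have "?W ^ ?n = ?W ^ k * ?W ^ (?n - k)"
      using True by (simp add: power_add[symmetric])
    ultimately show ?thesis by (simp add: power_mult_distrib mult_ac)
  next
    case False
    then have "n0 choose k = 0" using A(3) by (simp add: binomial_eq_0)
    then have zero: "real (n0 choose k) = 0" by simp
    show ?thesis unfolding zero using p w by simp
  qed
  with split show ?thesis by (simp add: algebra_simps)
qed

text \<open>Bins are treated one at a time. Once the set \<open>T\<close> of fewer than \<open>k\<close> balls in the current bin is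
  fixed, the remaining balls form a smaller instance with one bin less; as long as at least \<open>n0\<close>
  balls are left, each bin contributes a factor \<open>1 - q\<close>.\<close>

lemma sum_assignments_small_loads_le:
  fixes p :: "'j \<Rightarrow> real" and A :: "'a set"
  assumes "finite J" "finite A" "z \<notin> J" "card A \<le> L" "n0 + k * card J \<le> card A"
    and "0 \<le> p0" "2 * p1 \<le> 1" "\<And>j. j \<in> J \<Longrightarrow> p0 \<le> p j \<and> p j \<le> p1"
    and "1 / 2 \<le> p z" "(\<Sum>j\<in>insert z J. p j) \<le> 1"
  shows "(\<Sum>h | h \<in> (A \<rightarrow>\<^sub>E insert z J) \<and> (\<forall>j\<in>J. card {a \<in> A. h a = j} < k). \<Prod>a\<in>A. p (h a))
    \<le> (\<Sum>j\<in>insert z J. p j) ^ card A * (1 - real (n0 choose k) * p0 ^ k * (1 - 2 * p1) ^ L) ^ card J"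
  using assms
proof (induction J arbitrary: A rule: finite_induct)
  case empty
  have "(A \<rightarrow>\<^sub>E {z}) = {\<lambda>a\<in>A. z}"
    using PiE_singleton[of "\<lambda>a\<in>A. z" A] by (simp cong: PiE_cong)
  then show ?case by (simp add: prod.cong[of A A _ "\<lambda>_. p z"])
next
  case (insert j J)
  define S where "S A J = {h. h \<in> (A \<rightarrow>\<^sub>E insert z J) \<and> (\<forall>j\<in>J. card {a \<in> A. h a = j} < k)}"
    for A :: "'a set" and J
  define W where "W J = (\<Sum>j\<in>insert z J. p j)" for J
  define q where "q = real (n0 choose k) * p0 ^ k * (1 - 2 * p1) ^ L"
  have finS: "finite (S A J)" if "finite A" "finite J" for A J
    unfolding S_def using that by (auto intro!: finite_subset[OF _ finite_PiE[of A "\<lambda>_. insert z J"]])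
  have nonneg: "0 \<le> p i" if "i \<in> insert z (insert j J)" for i
    using that insert.prems by fastforce
  have zj: "z \<noteq> j" "z \<notin> J" using insert.prems by auto
  have Wj: "W (insert j J) = W J + p j"
    using insert.hyps zj by (simp add: W_def insert_commute[of z])
  have WJ: "1 / 2 \<le> W J"
    using insert.hyps zj insert.prems nonneg sum_nonneg[of J p] by (simp add: W_def)
  \<comment> \<open>Splits an assignment into the set of balls in bin \<open>j\<close> and the
    assignment of the others; the weight factors accordingly. Weights being nonnegative, injectivity
    and an inclusion of the image in \<open>?D\<close> suffice.\<close>
  let ?\<phi> = "\<lambda>h. ({a \<in> A. h a = j}, restrict h (A - {a \<in> A. h a = j}))"
  let ?D = "SIGMA T:{T. T \<subseteq> A \<and> card T < k}. S (A - T) J"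
  let ?F = "\<lambda>(T, h). p j ^ card T * (\<Prod>a\<in>A - T. p (h a))"
  have inj: "inj_on ?\<phi> (S A (insert j J))"
  proof (rule inj_onI)
    fix g h assume g: "g \<in> S A (insert j J)" and h: "h \<in> S A (insert j J)" and eq: "?\<phi> g = ?\<phi> h"
    show "g = h"
    proof (rule PiE_ext)
      show "g \<in> A \<rightarrow>\<^sub>E insert z (insert j J)" "h \<in> A \<rightarrow>\<^sub>E insert z (insert j J)"
        using g h by (auto simp: S_def)
      fix a assume a: "a \<in> A"
      have "{a \<in> A. g a = j} = {a \<in> A. h a = j}" using eq by simp
      then have ja: "g a = j \<longleftrightarrow> h a = j" using a by blast
      have "restrict g (A - {a \<in> A. g a = j}) a = restrict h (A - {a \<in> A. h a = j}) a"
        using arg_cong[OF eq, of "\<lambda>u. snd u a"] by simp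
      then show "g a = h a" using a ja by (auto split: if_splits)
    qed
  qed
  have image: "?\<phi> ` S A (insert j J) \<subseteq> ?D"
  proof safe
    fix h assume h: "h \<in> S A (insert j J)"
    then show "card {a \<in> A. h a = j} < k" by (simp add: S_def)
    have "{a \<in> A - {a \<in> A. h a = j}. restrict h (A - {a \<in> A. h a = j}) a = i} = {a \<in> A. h a = i}"
      if "i \<in> J" for i using that insert.hyps by auto
    then show "restrict h (A - {a \<in> A. h a = j}) \<in> S (A - {a \<in> A. h a = j}) J"
      using h by (fastforce simp: S_def)
  qed
  have weight: "(\<Prod>a\<in>A. p (h a)) = ?F (?\<phi> h)" for h
  proof -
    have "(\<Prod>a\<in>A. p (h a)) = (\<Prod>a\<in>{a \<in> A. h a = j}. p (h a)) * (\<Prod>a\<in>A - {a \<in> A. h a = j}. p (h a))"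
      using insert.prems by (subst prod.subset_diff[of "{a \<in> A. h a = j}"]) (auto simp: mult.commute)
    then show ?thesis by simp
  qed
  have "(\<Sum>h\<in>S A (insert j J). \<Prod>a\<in>A. p (h a)) = (\<Sum>x\<in>?\<phi> ` S A (insert j J). ?F x)"
    by (simp only: sum.reindex[OF inj] comp_def weight)
  also have "\<dots> \<le> (\<Sum>x\<in>?D. ?F x)"
  proof (rule sum_mono2[OF _ image])
    show "finite ?D" using insert.prems insert.hyps
      by (intro finite_SigmaI finS) (auto intro: finite_subset[of _ "Pow A"])
    show "0 \<le> ?F x" if "x \<in> ?D - ?\<phi> ` S A (insert j J)" for x
      using that by (auto simp: S_def intro!: mult_nonneg_nonneg prod_nonneg zero_le_power nonneg)
  qed
  also have "\<dots> = (\<Sum>T | T \<subseteq> A \<and> card T < k. p j ^ card T * (\<Sum>h\<in>S (A - T) J. \<Prod>a\<in>A - T. p (h a)))"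
    using insert.prems insert.hyps unfolding sum_distrib_left
    by (subst sum.Sigma) (auto intro!: finS intro: finite_subset[of _ "Pow A"])
  also have "\<dots> \<le> (\<Sum>T | T \<subseteq> A \<and> card T < k. p j ^ card T * (W J ^ card (A - T) * (1 - q) ^ card J))"
  proof (intro sum_mono mult_left_mono)
    fix T assume "T \<in> {T. T \<subseteq> A \<and> card T < k}"
    then have T: "T \<subseteq> A" "card T < k" by auto
    have card: "card (A - T) = card A - card T"
      using T insert.prems by (intro card_Diff_subset) (auto intro: finite_subset)
    \<comment> \<open>Fewer than \<open>k\<close> balls were removed, so at least
      \<open>n0 + k * card J\<close> are left for the remaining bins. The masses are not
      renormalised after leaving out \<open>j\<close>, which is why the claim carries a power of the
      total mass.\<close>
    have "(\<Sum>h | h \<in> ((A - T) \<rightarrow>\<^sub>E insert z J) \<and> (\<forall>j\<in>J. card {a \<in> A - T. h a = j} < k). \<Prod>a\<in>A - T. p (h a))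
      \<le> (\<Sum>j\<in>insert z J. p j) ^ card (A - T)
        * (1 - real (n0 choose k) * p0 ^ k * (1 - 2 * p1) ^ L) ^ card J"
      using insert.prems insert.hyps T card Wj nonneg[of j]
      by (intro insert.IH) (auto simp: W_def)
    then show "(\<Sum>h\<in>S (A - T) J. \<Prod>a\<in>A - T. p (h a)) \<le> W J ^ card (A - T) * (1 - q) ^ card J"
      by (simp add: S_def W_def q_def)
  qed (use nonneg in auto)
  also have "\<dots> = (\<Sum>T | T \<subseteq> A \<and> card T < k. p j ^ card T * W J ^ card (A - T)) * (1 - q) ^ card J"
    by (simp add: sum_distrib_right mult.assoc)
  also have "\<dots> \<le> (W (insert j J) ^ card A * (1 - q)) * (1 - q) ^ card J"
  proof -
    have tail: "(\<Sum>T | T \<subseteq> A \<and> card T < k. p j ^ card T * W J ^ card (A - T))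
        \<le> W (insert j J) ^ card A * (1 - q)"
      unfolding Wj q_def
      using insert.prems WJ Wj by (intro binomial_lower_tail_le) (auto simp: W_def)
    \<comment> \<open>Nonnegativity of \<open>1 - q\<close> is read off from the tail bound itself,
      whose left side has nonnegative terms.\<close>
    moreover have "0 \<le> (\<Sum>T | T \<subseteq> A \<and> card T < k. p j ^ card T * W J ^ card (A - T))"
      using nonneg[of j] WJ by (intro sum_nonneg) auto
    ultimately have "0 \<le> W (insert j J) ^ card A * (1 - q)" by linarith
    moreover have "W (insert j J) ^ card A > 0" using Wj WJ nonneg[of j] by simp
    ultimately have "0 \<le> 1 - q" by (simp add: zero_le_mult_iff)
    then show ?thesis using tail by (intro mult_right_mono) auto
  qed
  finally show ?case
    using insert.hyps by (simp add: S_def W_def q_def mult_ac)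
qed

text \<open>\<open>E\<close> is covered by finitely many product sets, one for each assignment of
  points to cells with small loads. Independence turns the measure of each into a product of cell
  probabilities, and the combinatorial estimate bounds their sum.\<close>

lemma (in prob_space) prob_all_loads_small_le:
  fixes B :: "'j \<Rightarrow> 'a set" and p0 p1 :: real
  assumes J: "finite J" and I: "finite I" and B: "\<And>j. j \<in> J \<Longrightarrow> B j \<in> events"
    and disj: "disjoint_family_on B J"
    and p: "0 \<le> p0" "\<And>j. j \<in> J \<Longrightarrow> p0 \<le> prob (B j) \<and> prob (B j) \<le> p1"
    and p1: "2 * p1 \<le> 1" "2 * (real (card J) * p1) \<le> 1" and n0: "n0 + k * card J \<le> card I"
    and E: "E \<subseteq> {x \<in> space (PiM I (\<lambda>_. M)). \<forall>j\<in>J. card {i \<in> I. x i \<in> B j} < k}"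
  shows "measure (PiM I (\<lambda>_. M)) E
    \<le> (1 - real (n0 choose k) * p0 ^ k * (1 - 2 * p1) ^ card I) ^ card J"
proof -
  interpret P: finite_product_prob_space "\<lambda>_. M" I by standard (rule I)
  \<comment> \<open>\<open>None\<close> stands for the cell outside all bins, so that the cells
    partition the space and the total mass is 1. This cell keeps probability at least 1/2, whichever
    bins have been removed.\<close>
  define C where "C = (\<lambda>c. case c of None \<Rightarrow> space M - (\<Union>j\<in>J. B j) | Some j \<Rightarrow> B j)"
  let ?J = "Some ` J"
  let ?S = "{h. h \<in> (I \<rightarrow>\<^sub>E insert None ?J) \<and> (\<forall>j\<in>?J. card {i \<in> I. h i = j} < k)}"
  have C: "C c \<in> events" if "c \<in> insert None ?J" for c
    using that B J by (auto simp: C_def intro!: sets.Diff sets.finite_UN)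
  have finS: "finite ?S"
    using I J by (auto intro!: finite_subset[OF _ finite_PiE[of I "\<lambda>_. insert None ?J"]])
  have None: "prob (C None) = 1 - prob (\<Union>j\<in>J. B j)"
    unfolding C_def using B J by (simp add: prob_compl[OF sets.finite_UN])
  have PiE_sets: "(\<Pi>\<^sub>E i\<in>I. C (h i)) \<in> sets (PiM I (\<lambda>_. M))" if "h \<in> ?S" for h
    using that C I by (intro sets_PiM_I_finite) (auto simp: PiE_def Pi_def)
  have "E \<subseteq> (\<Union>h\<in>?S. \<Pi>\<^sub>E i\<in>I. C (h i))"
  proof
    fix x assume "x \<in> E"
    then have x: "x \<in> space (PiM I (\<lambda>_. M))" "\<forall>j\<in>J. card {i \<in> I. x i \<in> B j} < k"
      using E by auto
    define h where "h = (\<lambda>i\<in>I. if \<exists>j\<in>J. x i \<in> B j then Some (THE j. j \<in> J \<and> x i \<in> B j) else None)"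
    have the: "(THE j. j \<in> J \<and> x i \<in> B j) = j" if "j \<in> J" "x i \<in> B j" for i j
      using that disj by (intro the_equality) (auto simp: disjoint_family_on_def)
    have hj: "h i = Some j \<longleftrightarrow> j \<in> J \<and> x i \<in> B j" if "i \<in> I" for i j
      using that the by (auto simp: h_def)
    have "{i \<in> I. h i = Some j} = {i \<in> I. x i \<in> B j}" if "j \<in> J" for j
      using that hj by auto
    moreover have "h \<in> I \<rightarrow>\<^sub>E insert None ?J"
    proof (rule PiE_I)
      show "h i \<in> insert None ?J" if "i \<in> I" for i
        using hj[OF that] by (cases "h i") auto
    qed (simp add: h_def)
    ultimately have "h \<in> ?S" using x by auto
    moreover have "x i \<in> C (h i)" if "i \<in> I" for i
    proof (cases "h i")
      case None
      then show ?thesis using x that hj[OF that] 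
        by (auto simp: C_def space_PiM h_def split: if_splits)
    next
      case (Some j)
      then show ?thesis using hj[OF that, of j] by (simp add: C_def)
    qed
    then have "x \<in> (\<Pi>\<^sub>E i\<in>I. C (h i))" using x by (auto simp: space_PiM PiE_def)
    ultimately show "x \<in> (\<Union>h\<in>?S. \<Pi>\<^sub>E i\<in>I. C (h i))" by blast
  qed
  then have "measure (PiM I (\<lambda>_. M)) E \<le> measure (PiM I (\<lambda>_. M)) (\<Union>h\<in>?S. \<Pi>\<^sub>E i\<in>I. C (h i))"
    using finS PiE_sets by (intro P.finite_measure_mono sets.finite_UN) auto
  also have "\<dots> \<le> (\<Sum>h\<in>?S. measure (PiM I (\<lambda>_. M)) (\<Pi>\<^sub>E i\<in>I. C (h i)))"
    using finS PiE_sets by (intro P.finite_measure_subadditive_finite) auto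
  also have "\<dots> = (\<Sum>h\<in>?S. \<Prod>i\<in>I. prob (C (h i)))"
    using C by (intro sum.cong refl P.finite_measure_PiM_emb) (auto simp: PiE_def Pi_def)
  also have "\<dots> \<le> (\<Sum>c\<in>insert None ?J. prob (C c)) ^ card I
      * (1 - real (n0 choose k) * p0 ^ k * (1 - 2 * p1) ^ card I) ^ card ?J"
  proof (rule sum_assignments_small_loads_le)
    have sum_Some: "(\<Sum>c\<in>?J. prob (C c)) = (\<Sum>j\<in>J. prob (B j))"
      by (simp add: sum.reindex C_def)
    have union: "prob (\<Union>j\<in>J. B j) = (\<Sum>j\<in>J. prob (B j))"
      using B J disj by (intro finite_measure_finite_Union) auto
    show "(\<Sum>c\<in>insert None ?J. prob (C c)) \<le> 1"
      using J by (simp add: sum_Some None union)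
    have "(\<Sum>j\<in>J. prob (B j)) \<le> card J * p1" using p by (intro sum_bounded_above) auto
    then show "1 / 2 \<le> prob (C None)" using p1 by (simp add: None union)
    show "n0 + k * card ?J \<le> card I" using n0 by (simp add: card_image)
  qed (use J I p p1 in \<open>auto simp: C_def\<close>)
  also have "(\<Sum>c\<in>insert None ?J. prob (C c)) = 1"
  proof -
    have "(\<Sum>c\<in>?J. prob (C c)) = prob (\<Union>j\<in>J. B j)"
      using B J disj by (subst finite_measure_finite_Union) (auto simp: sum.reindex C_def)
    then show ?thesis using J by (simp add: None)
  qed
  finally show ?thesis by (simp add: card_image)
qed

section \<open>Vandermonde matrices with clustered phases\<close>

lemma vandermonde_d_carrier: "vandermonde_d d N L x \<in> carrier_mat (N ^ d) L"
  by (simp add: vandermonde_d_def)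

text \<open>Every summand has real part at least cos(pi/3) = 1/2.\<close>

lemma cmod_sum_cis_ge:
  assumes "\<And>q. q \<in> Q \<Longrightarrow> \<bar>\<theta> q\<bar> \<le> pi / 3"
  shows "real (card Q) / 2 \<le> cmod (\<Sum>q\<in>Q. cis (\<theta> q))"
proof -
  have "cos (pi / 3) \<le> cos \<bar>\<theta> q\<bar>" if "q \<in> Q" for q
    using assms[OF that] pi_gt_zero by (intro cos_monotone_0_pi_le) auto
  then have "(\<Sum>q\<in>Q. 1 / 2) \<le> (\<Sum>q\<in>Q. cos (\<theta> q))"
    by (intro sum_mono) (simp add: cos_60)
  also have "\<dots> = Re (\<Sum>q\<in>Q. cis (\<theta> q))" by simp
  also have "\<dots> \<le> cmod (\<Sum>q\<in>Q. cis (\<theta> q))" by (rule complex_Re_le_cmod)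
  finally show ?thesis by simp
qed

text \<open>Within a cube of side \<open>1 / (6 d N)\<close> all phases of a fixed row agree up to \<open>pi / 3\<close>, so no
  cancellation occurs when the corresponding columns are added.\<close>

lemma
  fixes x :: "nat \<Rightarrow> nat \<Rightarrow> real"
  assumes d: "d > 0" and N: "N > 0" and Q: "Q \<subseteq> {..<L}" "Q \<noteq> {}"
    and x: "\<And>q j. q \<in> Q \<Longrightarrow> j < d \<Longrightarrow> x q j \<in> {c j .. c j + 1 / (6 * real d * real N)}"
  defines "V \<equiv> vandermonde_d d N L x" and "v \<equiv> vec L (\<lambda>q. if q \<in> Q then 1 else 0)"
  shows cvec_sq_vandermonde_clustered: "cvec_sq (V *\<^sub>v v) > 0"
    and largest_eigenvalue_vandermonde_ge: "real (card Q) / 4 \<le> largest_eigenvalue (mat_adjoint V * V)"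
proof -
  have fin: "finite Q" using Q(1) by (rule finite_subset) simp
  have V: "V \<in> carrier_mat (N ^ d) L" unfolding V_def by (rule vandermonde_d_carrier)
  have v: "v \<in> carrier_vec L" by (simp add: v_def)
  define s where "s r y = (\<Sum>j<d. real ((r div N ^ j) mod N) * y j)" for r and y :: "nat \<Rightarrow> real"
  have entry: "(V *\<^sub>v v) $ r = complex_of_real (real N powr (- real d / 2)) * (\<Sum>q\<in>Q. cis (2 * pi * s r (x q)))"
    if r: "r < N ^ d" for r
  proof -
    have "(V *\<^sub>v v) $ r = (\<Sum>q<L. V $$ (r, q) * (if q \<in> Q then 1 else 0))"
      using V r by (auto simp: scalar_prod_def atLeast0LessThan v_def intro!: sum.cong)
    also have "\<dots> = (\<Sum>q\<in>Q. V $$ (r, q))"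
      using Q(1) by (simp add: if_distrib[of "\<lambda>y. _ * y"] sum.If_cases Int_absorb1 cong: if_cong)
    also have "\<dots> = (\<Sum>q\<in>Q. complex_of_real (real N powr (- real d / 2)) * cis (2 * pi * s r (x q)))"
      using Q(1) r by (intro sum.cong refl) (auto simp: V_def vandermonde_d_def s_def cis_conv_exp mult_ac)
    finally show ?thesis by (simp add: sum_distrib_left)
  qed
  have row: "(1 / real N ^ d) * ((real (card Q))\<^sup>2 / 4) \<le> (cmod ((V *\<^sub>v v) $ r))\<^sup>2" if r: "r < N ^ d" for r
  proof -
    \<comment> \<open>The digits of \<open>r\<close> are below \<open>N\<close>, so over
      \<open>d\<close> coordinates a side of 1/(6dN) changes the inner product by at most 1/6; times
      2 pi this is pi/3. The common phase of the corner \<open>c\<close> is factored out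
      afterwards.\<close>
    have phase: "\<bar>2 * pi * (s r (x q) - s r c)\<bar> \<le> pi / 3" if q: "q \<in> Q" for q
    proof -
      have "s r (x q) - s r c = (\<Sum>j<d. real ((r div N ^ j) mod N) * (x q j - c j))"
        by (simp add: s_def sum_subtractf right_diff_distrib)
      moreover have "0 \<le> (\<Sum>j<d. real ((r div N ^ j) mod N) * (x q j - c j))"
        using x[OF q] by (intro sum_nonneg) auto
      moreover have "(\<Sum>j<d. real ((r div N ^ j) mod N) * (x q j - c j))
          \<le> (\<Sum>j<d. real N * (1 / (6 * real d * real N)))"
      proof (intro sum_mono mult_mono)
        fix j assume "j \<in> {..<d}"
        then show "x q j - c j \<le> 1 / (6 * real d * real N)" "0 \<le> x q j - c j"
          using x[OF q, of j] by auto
        show "real (r div N ^ j mod N) \<le> real N" using N by (simp add: less_imp_le)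
      qed simp
      moreover have "(\<Sum>j<d. real N * (1 / (6 * real d * real N))) = 1 / 6"
        using d N by simp
      ultimately have "0 \<le> s r (x q) - s r c" "s r (x q) - s r c \<le> 1 / 6" by auto
      then show ?thesis by (simp add: abs_mult)
    qed
    have "(\<Sum>q\<in>Q. cis (2 * pi * s r (x q)))
        = cis (2 * pi * s r c) * (\<Sum>q\<in>Q. cis (2 * pi * (s r (x q) - s r c)))"
      by (simp add: sum_distrib_left cis_mult right_diff_distrib)
    then have "real (card Q) / 2 \<le> cmod (\<Sum>q\<in>Q. cis (2 * pi * s r (x q)))"
      using cmod_sum_cis_ge[of Q "\<lambda>q. 2 * pi * (s r (x q) - s r c)", OF phase] by (simp add: norm_mult)
    then have sum_ge: "(real (card Q) / 2)\<^sup>2 \<le> (cmod (\<Sum>q\<in>Q. cis (2 * pi * s r (x q))))\<^sup>2"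
      by (intro power_mono) auto
    have "(real N powr (- real d / 2))\<^sup>2 = 1 / real N ^ d"
      using N by (simp add: power2_eq_square powr_add[symmetric] powr_minus powr_realpow divide_simps)
    then have "(cmod ((V *\<^sub>v v) $ r))\<^sup>2 = (1 / real N ^ d) * (cmod (\<Sum>q\<in>Q. cis (2 * pi * s r (x q))))\<^sup>2"
      by (simp add: entry[OF r] norm_mult power_mult_distrib)
    with sum_ge show ?thesis by (simp only:) (intro mult_left_mono, simp_all add: power_divide)
  qed
  \<comment> \<open>Each of the N^d rows contributes at least |Q|^2 / (4 N^d). Since |v|^2 = |Q|,
    the Rayleigh quotient is at least |Q| / 4.\<close>
  have lower: "(real (card Q))\<^sup>2 / 4 \<le> cvec_sq (V *\<^sub>v v)"
  proof -
    have "(real (card Q))\<^sup>2 / 4 = (\<Sum>r<N ^ d. (1 / real N ^ d) * ((real (card Q))\<^sup>2 / 4))"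
      using N by simp
    also have "\<dots> \<le> (\<Sum>r<N ^ d. (cmod ((V *\<^sub>v v) $ r))\<^sup>2)"
      by (intro sum_mono row) simp
    also have "\<dots> = cvec_sq (V *\<^sub>v v)"
      using V by (simp add: cvec_sq_def)
    finally show ?thesis .
  qed
  have card: "card Q > 0" using Q fin by (simp add: card_gt_0_iff)
  show pos: "cvec_sq (V *\<^sub>v v) > 0"
    by (rule less_le_trans[OF _ lower]) (use card in simp)
  have "cvec_sq v = (\<Sum>q<L. if q \<in> Q then 1 else 0)"
    unfolding cvec_sq_def v_def by (auto intro!: sum.cong)
  then have "cvec_sq v = real (card Q)"
    using Q(1) by (simp add: sum.If_cases Int_absorb1)
  then have "(real (card Q))\<^sup>2 / 4 \<le> largest_eigenvalue (mat_adjoint V * V) * real (card Q)"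
    using lower cvec_sq_le_largest_eigenvalue_gram[OF V v pos v] by simp
  then show "real (card Q) / 4 \<le> largest_eigenvalue (mat_adjoint V * V)"
    using card by (simp add: power2_eq_square)
qed

lemma sets_phase_distr: "sets (phase_distr d f) = sets (lebesgue_d d)"
  by (simp add: phase_distr_def)

text \<open>The entries of the Gram matrix are finite sums of products of exponentials of the
  coordinates, hence measurable, and the event says that some real eigenvalue is at least
  \<open>c\<close>.\<close>

lemma measurable_largest_eigenvalue_vandermonde:
  assumes d: "d > 0" and N: "N > 0" and L: "L > 0"
  shows "{x \<in> space (phases_distr d f L).
      c \<le> largest_eigenvalue (mat_adjoint (vandermonde_d d N L x) * vandermonde_d d N L x)}
    \<in> sets (phases_distr d f L)"
proof -
  let ?M = "phases_distr d f L"
  let ?V = "vandermonde_d d N L"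
  let ?A = "\<lambda>x. mat_adjoint (?V x) * ?V x"
  have iff: "c \<le> largest_eigenvalue (?A x) \<longleftrightarrow> (\<exists>r\<ge>c. eigenvalue (?A x) (complex_of_real r))" for x
  proof (rule largest_eigenvalue_gram_ge_iff[OF vandermonde_d_carrier])
    \<comment> \<open>A single column is a cluster of one point with corner \<open>x 0\<close>;
      hence the image of this vector is nonzero for every \<open>x\<close>.\<close>
    show "cvec_sq (?V x *\<^sub>v vec L (\<lambda>q. if q \<in> {0} then 1 else 0)) > 0"
      using d N L by (intro cvec_sq_vandermonde_clustered[where c = "x 0"]) auto
  qed simp
  have A: "?A x \<in> carrier_mat L L" for x
    using mat_adjoint_carrier[OF vandermonde_d_carrier] vandermonde_d_carrier by (rule mult_carrier_mat)
  have coord: "(\<lambda>x. x q j) \<in> borel_measurable ?M" if "q < L" "j < d" for q j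
  proof -
    have "(\<lambda>x. x q) \<in> measurable ?M (phase_distr d f)"
      unfolding phases_distr_def using that by (intro measurable_component_singleton) simp
    moreover have "(\<lambda>y. y j) \<in> borel_measurable (phase_distr d f)"
      unfolding measurable_cong_sets[OF sets_phase_distr refl] lebesgue_d_def
      using that measurable_component_singleton[of j "{..<d}" "\<lambda>_. lborel"] by simp
    ultimately show ?thesis by (rule measurable_compose)
  qed
  have entry: "(\<lambda>x. ?V x $$ (r, q)) \<in> borel_measurable ?M" if "r < N ^ d" "q < L" for r q
  proof -
    have [measurable]: "(\<lambda>x. \<Sum>j<d. real ((r div N ^ j) mod N) * x q j) \<in> borel_measurable ?M"
      using that by (intro borel_measurable_sum borel_measurable_times borel_measurable_const coord) auto
    have eq: "?V x $$ (r, q) = complex_of_real (real N powr (- real d / 2)) *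
        exp (2 * pi * \<i> * complex_of_real (\<Sum>j<d. real ((r div N ^ j) mod N) * x q j))" for x
      using that by (simp add: vandermonde_d_def)
    show ?thesis unfolding eq by measurable
  qed
  have "(\<lambda>x. ?A x $$ (i, j)) \<in> borel_measurable ?M" if "i < L" "j < L" for i j
  proof -
    have eq: "?A x $$ (i, j) = (\<Sum>r<N ^ d. cnj (?V x $$ (r, i)) * ?V x $$ (r, j))" for x
    proof -
      have V: "?V x \<in> carrier_mat (N ^ d) L" by (rule vandermonde_d_carrier)
      show ?thesis
        using that V mat_adjoint_carrier[OF V]
        by (auto simp: scalar_prod_def atLeast0LessThan mat_adjoint_index[OF V] intro!: sum.cong)
    qed
    have cnj: "cnj \<in> borel_measurable borel"
      by (intro borel_measurable_continuous_onI continuous_intros)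
    show ?thesis
      unfolding eq using that
      by (intro borel_measurable_sum borel_measurable_times entry measurable_compose[OF entry cnj]) auto
  qed
  from measurable_ex_eigenvalue_ge[OF A this] show ?thesis
    unfolding iff .
qed

section \<open>The phase distribution: density bounds and probabilities of boxes\<close>

text \<open>Tychonoff: inside the full function space the coordinates from \<open>d\<close> on are
  pinned to the single value \<open>undefined\<close>. This is the topology in which continuity of
  the density on \<open>unit_cube d\<close> is meant.\<close>

lemma compact_unit_cube: "compact (unit_cube d)"
proof -
  have "unit_cube d = PiE UNIV (\<lambda>i. if i < d then {0..1} else {undefined})"
    by (auto simp: unit_cube_def PiE_def Pi_def extensional_def split: if_splits)
  moreover have "compactin (product_topology (\<lambda>_. euclidean) UNIV)
      (PiE UNIV (\<lambda>i. if i < d then {0..1} else {undefined :: real}))"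
    by (subst compactin_PiE) auto
  ultimately show ?thesis by (simp add: euclidean_product_topology)
qed

lemma continuous_on_unit_cube_bounds:
  assumes "continuous_on (unit_cube d) f" "\<forall>x\<in>unit_cube d. f x > 0"
  obtains m F :: real where "0 < m" "0 < F" "\<And>x. x \<in> unit_cube d \<Longrightarrow> m \<le> f x \<and> f x \<le> F"
proof -
  have ne: "unit_cube d \<noteq> {}" by (auto simp: unit_cube_def PiE_eq_empty_iff)
  obtain a where a: "a \<in> unit_cube d" "\<And>x. x \<in> unit_cube d \<Longrightarrow> f a \<le> f x"
    using continuous_attains_inf[OF compact_unit_cube ne assms(1)] by blast
  obtain b where b: "b \<in> unit_cube d" "\<And>x. x \<in> unit_cube d \<Longrightarrow> f x \<le> f b"
    using continuous_attains_sup[OF compact_unit_cube ne assms(1)] by blast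
  show thesis using that[of "f a" "f b"] a b assms(2) by auto
qed

lemma prob_space_phase_distr:
  assumes f: "f \<in> borel_measurable (lebesgue_d d)"
    and int: "(\<integral>\<^sup>+ x. indicator (unit_cube d) x * ennreal (f x) \<partial>lebesgue_d d) = 1"
  shows "prob_space (phase_distr d f)"
proof
  have [measurable]: "unit_cube d \<in> sets (lebesgue_d d)"
    unfolding unit_cube_def lebesgue_d_def by (intro sets_PiM_I_finite) auto
  have "emeasure (phase_distr d f) (space (lebesgue_d d))
      = (\<integral>\<^sup>+ x. indicator (unit_cube d) x * ennreal (f x) * indicator (space (lebesgue_d d)) x \<partial>lebesgue_d d)"
    unfolding phase_distr_def using f by (intro emeasure_density; measurable)
  also have "\<dots> = (\<integral>\<^sup>+ x. indicator (unit_cube d) x * ennreal (f x) \<partial>lebesgue_d d)"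
    by (intro nn_integral_cong) simp
  finally show "emeasure (phase_distr d f) (space (phase_distr d f)) = 1"
    using int by (simp add: phase_distr_def)
qed

lemma measure_phase_distr_box:
  fixes a :: "nat \<Rightarrow> real"
  assumes f: "f \<in> borel_measurable (lebesgue_d d)"
    and int: "(\<integral>\<^sup>+ x. indicator (unit_cube d) x * ennreal (f x) \<partial>lebesgue_d d) = 1"
    and bounds: "0 \<le> m" "0 \<le> F" "\<And>x. x \<in> unit_cube d \<Longrightarrow> m \<le> f x \<and> f x \<le> F"
    and a: "\<And>j. j < d \<Longrightarrow> 0 \<le> a j \<and> a j + \<delta> \<le> 1" and \<delta>: "0 \<le> \<delta>"
  defines "B \<equiv> PiE {..<d} (\<lambda>j. {a j .. a j + \<delta>})"
  shows "B \<in> sets (phase_distr d f)"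
    and "m * \<delta> ^ d \<le> measure (phase_distr d f) B" and "measure (phase_distr d f) B \<le> F * \<delta> ^ d"
proof -
  interpret P: prob_space "phase_distr d f" by (rule prob_space_phase_distr[OF f int])
  interpret S: product_sigma_finite "\<lambda>_ :: nat. lborel :: real measure" ..
  have [measurable]: "unit_cube d \<in> sets (lebesgue_d d)"
    unfolding unit_cube_def lebesgue_d_def by (intro sets_PiM_I_finite) auto
  have B [measurable]: "B \<in> sets (lebesgue_d d)"
    unfolding B_def lebesgue_d_def by (intro sets_PiM_I_finite) auto
  then show "B \<in> sets (phase_distr d f)" by (simp add: phase_distr_def)
  have sub: "B \<subseteq> unit_cube d"
  proof
    fix x assume x: "x \<in> B"
    have "x j \<in> {0..1}" if "j < d" for j
      using x a[OF that] that by (force simp: B_def PiE_def Pi_def)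
    then show "x \<in> unit_cube d" using x by (auto simp: B_def unit_cube_def PiE_def Pi_def)
  qed
  have vol: "emeasure (lebesgue_d d) B = ennreal (\<delta> ^ d)"
    unfolding B_def lebesgue_d_def using \<delta> by (subst S.emeasure_PiM) (auto simp: ennreal_power)
  have em: "emeasure (phase_distr d f) B
      = (\<integral>\<^sup>+ x. indicator (unit_cube d) x * ennreal (f x) * indicator B x \<partial>lebesgue_d d)"
    unfolding phase_distr_def using f by (intro emeasure_density; measurable)
  have const: "(\<integral>\<^sup>+ x. ennreal c * indicator B x \<partial>lebesgue_d d) = ennreal (c * \<delta> ^ d)" if "0 \<le> c" for c
    using that \<delta> by (subst nn_integral_cmult_indicator) (auto simp: vol ennreal_mult)
  have "ennreal (m * \<delta> ^ d) \<le> emeasure (phase_distr d f) B"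
    unfolding em const[OF bounds(1), symmetric]
    using sub bounds(3) by (intro nn_integral_mono) (auto split: split_indicator intro!: ennreal_leI)
  then show "m * \<delta> ^ d \<le> measure (phase_distr d f) B"
    using bounds(1) \<delta> by (simp add: P.emeasure_eq_measure)
  have "emeasure (phase_distr d f) B \<le> ennreal (F * \<delta> ^ d)"
    unfolding em const[OF bounds(2), symmetric]
    using sub bounds(3) by (intro nn_integral_mono) (auto split: split_indicator intro!: ennreal_leI)
  then show "measure (phase_distr d f) B \<le> F * \<delta> ^ d"
    using bounds(2) \<delta> by (simp add: P.emeasure_eq_measure)
qed

section \<open>Asymptotics\<close>

text \<open>Here \<open>t\<close> stands for N, \<open>d * ln t\<close> for ln N^d and 1/(G N^d) for
  the volume of a small cube; the \<open>+ 1\<close> absorbs rounding up to the cluster size k. The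
  bounds say in turn that rounding costs at most a factor 2, that k is at most quadratic in the
  logarithm, that the balls used up by sqrt N bins are few, that enough balls remain for a cluster,
  and that one bin and all bins together have small probability.\<close>

lemma eventually_grid_asymptotics:
  fixes \<kappa> d G \<beta> c1 F :: real
  assumes "\<kappa> > 0" "d > 0" "G > 0" "\<beta> > 0" "c1 > 0" "F > 0"
  shows "\<forall>\<^sub>F t in at_top. 16 \<le> t \<and> 1 \<le> ln (d * ln t)
    \<and> \<kappa> * (d * ln t) / ln (d * ln t) + 1 \<le> 2 * \<kappa> * (d * ln t) / ln (d * ln t)
    \<and> \<kappa> * (d * ln t) / ln (d * ln t) + 1 \<le> c1 * (d * ln t)\<^sup>2
    \<and> (\<kappa> * (d * ln t) / ln (d * ln t) + 1) * sqrt t \<le> \<beta> / 4 * t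
    \<and> \<kappa> * (d * ln t) / ln (d * ln t) + 1 \<le> \<beta> / 4 * t
    \<and> F / (G * t) \<le> 1 / 4 \<and> 2 * (sqrt t * (F / (G * t))) \<le> 1"
proof -
  have "\<forall>\<^sub>F t in at_top. (16 :: real) \<le> t" by (rule eventually_ge_at_top)
  moreover have "\<forall>\<^sub>F t in at_top. 1 \<le> ln (d * ln t)" using assms by real_asymp
  moreover have "\<forall>\<^sub>F t in at_top. \<kappa> * (d * ln t) / ln (d * ln t) + 1 \<le> 2 * \<kappa> * (d * ln t) / ln (d * ln t)"
    using assms by real_asymp
  moreover have "\<forall>\<^sub>F t in at_top. \<kappa> * (d * ln t) / ln (d * ln t) + 1 \<le> c1 * (d * ln t)\<^sup>2"
    using assms by real_asymp
  moreover have "\<forall>\<^sub>F t in at_top. (\<kappa> * (d * ln t) / ln (d * ln t) + 1) * sqrt t \<le> \<beta> / 4 * t"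
    using assms by real_asymp
  moreover have "\<forall>\<^sub>F t in at_top. \<kappa> * (d * ln t) / ln (d * ln t) + 1 \<le> \<beta> / 4 * t"
    using assms by real_asymp
  moreover have "\<forall>\<^sub>F t in at_top. F / (G * t) \<le> 1 / 4" using assms by real_asymp
  moreover have "\<forall>\<^sub>F t in at_top. 2 * (sqrt t * (F / (G * t))) \<le> 1" using assms by real_asymp
  ultimately show ?thesis by eventually_elim blast
qed

text \<open>Since (n0 choose k) \<ge> (n0/k)^k, the first two factors are at least (c1/k)^k \<ge>
  1/R. For the last one, 1 - 2 p1 \<ge> exp(-4 p1) when 4 p1 \<le> 1, because (1 - 2 p1)(1 + 4 p1)
  \<ge> 1.\<close>

lemma bin_hit_probability_ge:
  fixes p0 p1 c1 c2 R :: real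
  assumes k: "0 < k" "k \<le> n0" and c1: "c1 > 0" "c1 \<le> real n0 * p0" "(real k / c1) ^ k \<le> R"
    and p1: "0 \<le> p1" "4 * p1 \<le> 1" "p1 * real L \<le> c2"
  shows "exp (- (4 * c2)) / R \<le> real (n0 choose k) * p0 ^ k * (1 - 2 * p1) ^ L"
proof -
  have p0: "p0 \<ge> 0" using c1 k by (smt (verit) of_nat_0_le_iff mult_nonneg_nonpos)
  have R: "R > 0" using c1 k by (smt (verit) divide_pos_pos of_nat_0_less_iff zero_less_power)
  have pos: "(real k / c1) ^ k > 0" using k c1 by simp
  have "1 / R \<le> 1 / (real k / c1) ^ k"
    using c1(3) pos R by (intro divide_left_mono) auto
  also have "\<dots> = (c1 / real k) ^ k" by (simp add: power_divide)
  also have "\<dots> \<le> (real n0 / real k * p0) ^ k"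
    using c1 k by (intro power_mono) (auto simp: divide_right_mono)
  also have "\<dots> = (real n0 / real k) ^ k * p0 ^ k" by (rule power_mult_distrib)
  also have "\<dots> \<le> real (n0 choose k) * p0 ^ k"
    using k p0 binomial_ge_n_over_k_pow_k[OF k(2), where 'a = real] by (intro mult_right_mono) auto
  finally have choose: "1 / R \<le> real (n0 choose k) * p0 ^ k" .
  have "exp (- (4 * c2)) \<le> exp (- (4 * p1)) ^ L"
    using p1 by (simp add: exp_of_nat_mult[symmetric] mult_ac)
  also have "exp (- (4 * p1)) \<le> 1 - 2 * p1"
  proof -
    have "(1 - 2 * p1) * exp (4 * p1) \<ge> (1 - 2 * p1) * (1 + 4 * p1)"
      using p1 exp_ge_add_one_self[of "4 * p1"] by (intro mult_left_mono) auto
    moreover have "(1 - 2 * p1) * (1 + 4 * p1) \<ge> 1"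
      using p1 mult_mono[of "4 * p1" 1 p1 p1] by (simp add: algebra_simps)
    ultimately have "1 \<le> (1 - 2 * p1) * exp (4 * p1)" by linarith
    then show ?thesis by (simp add: exp_minus divide_simps)
  qed
  then have "exp (- (4 * p1)) ^ L \<le> (1 - 2 * p1) ^ L" by (rule power_mono) simp
  finally have "exp (- (4 * c2)) \<le> (1 - 2 * p1) ^ L" .
  then have "1 / R * exp (- (4 * c2)) \<le> (real (n0 choose k) * p0 ^ k) * (1 - 2 * p1) ^ L"
    using choose p0 by (intro mult_mono) auto
  then show ?thesis by simp
qed

text \<open>The crude bound k/c1 \<le> u^2 turns the power into exp(2 k ln u), and k ln u \<le> 2
  \<kappa> u by the choice of k of order u / ln u.\<close>

lemma power_le_exp_of_log:
  fixes u \<kappa> c1 :: real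
  assumes k: "0 < k" and c1: "c1 > 0" and u: "u > 0" "1 \<le> ln u"
    and le: "real k \<le> 2 * \<kappa> * u / ln u" "real k \<le> c1 * u\<^sup>2"
  shows "(real k / c1) ^ k \<le> exp (4 * \<kappa> * u)"
proof -
  have "(real k / c1) ^ k \<le> (u\<^sup>2) ^ k"
    using c1 le(2) by (intro power_mono) (auto simp: divide_simps mult_ac)
  also have "\<dots> = exp (2 * (real k * ln u))"
  proof -
    have "u\<^sup>2 = exp (2 * ln u)" using u(1) by (simp add: exp_double)
    then show ?thesis by (simp add: exp_of_nat_mult[symmetric] mult_ac)
  qed
  also have "real k * ln u \<le> 2 * \<kappa> * u"
    using le(1) u(2) by (subst (asm) pos_le_divide_eq) auto
  then have "exp (2 * (real k * ln u)) \<le> exp (4 * \<kappa> * u)" by simp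
  finally show ?thesis .
qed

section \<open>From clusters to the eigenvalue bound\<close>

lemma prob_largest_eigenvalue_ge:
  fixes f :: "(nat \<Rightarrow> real) \<Rightarrow> real" and m F c :: real
  assumes d: "d > 0" and N: "N > 0" and L: "L > 0" and k: "k > 0" and J: "0 < J" "J \<le> N"
    and f: "f \<in> borel_measurable (lebesgue_d d)"
    and int: "(\<integral>\<^sup>+ x. indicator (unit_cube d) x * ennreal (f x) \<partial>lebesgue_d d) = 1"
    and bounds: "0 \<le> m" "0 \<le> F" "\<And>x. x \<in> unit_cube d \<Longrightarrow> m \<le> f x \<and> f x \<le> F"
    and c: "c \<le> real k / 4"
  defines "p0 \<equiv> m * (1 / (6 * real d * real N)) ^ d" and "p1 \<equiv> F * (1 / (6 * real d * real N)) ^ d"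
  assumes p1: "2 * p1 \<le> 1" "2 * (real J * p1) \<le> 1" and n0: "n0 + k * J \<le> L"
  shows "1 - exp (- (real (n0 choose k) * p0 ^ k * (1 - 2 * p1) ^ L) * real J)
    \<le> measure (phases_distr d f L) {x \<in> space (phases_distr d f L).
        c \<le> largest_eigenvalue (mat_adjoint (vandermonde_d d N L x) * vandermonde_d d N L x)}"
proof -
  let ?M = "phases_distr d f L"
  let ?ev = "\<lambda>x. largest_eigenvalue (mat_adjoint (vandermonde_d d N L x) * vandermonde_d d N L x)"
  let ?\<delta> = "1 / (6 * real d * real N)"
  define q where "q = real (n0 choose k) * p0 ^ k * (1 - 2 * p1) ^ L"
  \<comment> \<open>The boxes are lined up along coordinate 0 with corners at j/N. Their side is
    strictly below 1/N, so even the closed boxes are disjoint, and J \<le> N keeps them inside the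
    cube.\<close>
  define a where "a = (\<lambda>(j :: nat) (i :: nat). if i = 0 then real j / real N else 0)"
  define B where "B = (\<lambda>j. PiE {..<d} (\<lambda>i. {a j i .. a j i + ?\<delta>}))"
  interpret P: prob_space "phase_distr d f" by (rule prob_space_phase_distr[OF f int])
  interpret PP: prob_space ?M
    unfolding phases_distr_def by (intro prob_space_PiM P.prob_space_axioms)
  have side: "0 \<le> ?\<delta>" "?\<delta> < 1 / real N"
    using d N by (auto simp: divide_simps)
  have inside: "0 \<le> a j i \<and> a j i + ?\<delta> \<le> 1" if "j < J" for i j
  proof -
    have "1 / real N \<le> 1" using N by simp
    then have "?\<delta> \<le> 1" using side(2) by linarith
    moreover have "(real j + 1) / real N \<le> 1" using that J N by simp
    ultimately show ?thesis using side N by (auto simp: a_def add_divide_distrib)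
  qed
  have box: "B j \<in> P.events" "p0 \<le> P.prob (B j)" "P.prob (B j) \<le> p1" if "j < J" for j
    unfolding B_def p0_def p1_def
    using measure_phase_distr_box[OF f int bounds inside[OF that] side(1)] by auto
  have disj: "disjoint_family_on B {..<J}"
    unfolding disjoint_family_on_def
  proof (intro ballI impI, rule ccontr)
    fix i j assume ij: "i \<noteq> j" and "B i \<inter> B j \<noteq> {}"
    then obtain y where "y \<in> B i" "y \<in> B j" by blast
    then have y: "y 0 \<in> {real i / real N .. real i / real N + ?\<delta>}" "y 0 \<in> {real j / real N .. real j / real N + ?\<delta>}"
      using d by (auto simp: B_def a_def PiE_def Pi_def)
    have sep: "real i' / real N + 1 / real N \<le> real j' / real N" if "i' < j'" for i' j' :: nat
      using that N by (simp add: add_divide_distrib[symmetric] divide_right_mono)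
    consider "i < j" | "j < i" using ij by linarith
    then show False
    proof cases
      case 1 then show False using sep[OF 1] y side(2) by auto
    next
      case 2 then show False using sep[OF 2] y side(2) by auto
    qed
  qed
  have p0: "0 \<le> p0" using bounds by (simp add: p0_def)
  have p01: "p0 \<le> p1" using box(2,3)[of 0] J by linarith
  \<comment> \<open>The tail bound for \<open>n0\<close> balls with masses \<open>p0\<close> and
    \<open>1 - p0\<close>, whose total is 1, gives \<open>1 - q\<close> \<ge> 0; this is required to
    pass to powers below.\<close>
  have q: "0 \<le> 1 - q"
  proof -
    have "(\<Sum>T | T \<subseteq> {..<n0} \<and> card T < k. p0 ^ card T * (1 - p0) ^ card ({..<n0} - T))
        \<le> ((1 - p0) + p0) ^ card {..<n0} * (1 - q)"
      unfolding q_def using n0 p0 p01 p1 by (intro binomial_lower_tail_le) auto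
    moreover have "0 \<le> (\<Sum>T | T \<subseteq> {..<n0} \<and> card T < k. p0 ^ card T * (1 - p0) ^ card ({..<n0} - T))"
      using p0 p01 p1 by (intro sum_nonneg) auto
    ultimately show ?thesis by simp
  qed
  define E where "E = {x \<in> space ?M. c \<le> ?ev x}"
  have E: "E \<in> PP.events"
    unfolding E_def by (rule measurable_largest_eigenvalue_vandermonde[OF d N L])
  have "space ?M - E \<subseteq> {x \<in> space ?M. \<forall>j\<in>{..<J}. card {i \<in> {..<L}. x i \<in> B j} < k}"
  proof (intro subsetI CollectI conjI ballI)
    fix x j assume x: "x \<in> space ?M - E" and j: "j \<in> {..<J}"
    show "card {i \<in> {..<L}. x i \<in> B j} < k"
    proof (rule ccontr)
      let ?Q = "{i \<in> {..<L}. x i \<in> B j}"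
      assume "\<not> card ?Q < k"
      then have card: "k \<le> card ?Q" by simp
      then have "?Q \<noteq> {}" using k by (metis card.empty not_le)
      then have "real (card ?Q) / 4 \<le> ?ev x"
        by (intro largest_eigenvalue_vandermonde_ge[OF d N, where c = "a j"]) (auto simp: B_def PiE_def Pi_def)
      then have "c \<le> ?ev x" using card c by linarith
      with x show False by (simp add: E_def)
    qed
  qed simp
  then have "PP.prob (space ?M - E) \<le> (1 - q) ^ J"
    using P.prob_all_loads_small_le[of "{..<J}" "{..<L}" B p0 p1 n0 k] box disj p0 p1 n0
    by (simp add: phases_distr_def q_def)
  also have "\<dots> \<le> exp (- q) ^ J"
    using q exp_ge_add_one_self[of "- q"] by (intro power_mono) auto
  also have "\<dots> = exp (- q * real J)" by (simp add: exp_of_nat_mult[symmetric] mult.commute)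
  finally show ?thesis
    using PP.prob_compl[OF E] by (simp add: q_def E_def)
qed

theorem mainTheorem6:
  fixes d :: nat and f :: "(nat \<Rightarrow> real) \<Rightarrow> real" and \<beta> :: real
  assumes d_pos: "d \<ge> 1"
    and f_meas: "f \<in> borel_measurable (lebesgue_d d)"
    and f_cont: "continuous_on (unit_cube d) f"
    and f_min: "\<forall>x \<in> unit_cube d. f x > 0"
    and f_int: "(\<integral>\<^sup>+ x. indicator (unit_cube d) x * ennreal (f x) \<partial>lebesgue_d d) = 1"
    and beta_pos: "\<beta> > 0"
  shows "\<exists>K > 0. \<forall>N L :: nat \<Rightarrow> nat.
           filterlim N at_top sequentially \<longrightarrow>
           filterlim L at_top sequentially \<longrightarrow>
           (\<lambda>n. real (L n) / real (N n) ^ d) \<longlonglongrightarrow> \<beta> \<longrightarrow>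
           (\<lambda>n. measure (phases_distr d f (L n))
                 {x \<in> space (phases_distr d f (L n)).
                    largest_eigenvalue (mat_adjoint (vandermonde_d d (N n) (L n) x) * vandermonde_d d (N n) (L n) x)
                    \<ge> K * ln (real (N n) ^ d) / ln (ln (real (N n) ^ d))})
           \<longlonglongrightarrow> 1"
proof -
  obtain m F where m: "0 < m" and F: "0 < F" and bounds: "\<And>x. x \<in> unit_cube d \<Longrightarrow> m \<le> f x \<and> f x \<le> F"
    using continuous_on_unit_cube_bounds[OF f_cont f_min] by metis
  \<comment> \<open>With this value \<open>4 * \<kappa> * u\<close> equals \<open>ln t / 4\<close>
    for u = d ln t, so a bin is hit with probability at least a constant times N^(-1/4), against
    about sqrt N bins.\<close>
  define \<kappa> where "\<kappa> = 1 / (16 * real d)"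
  define G where "G = (6 * real d) ^ d"
  \<comment> \<open>\<open>c1\<close> bounds \<open>n0 * p0\<close> from below, using n0 \<ge>
    \<beta>/4 N^d, and \<open>c2\<close> bounds \<open>p1 * L\<close> from above, using L \<le> 2
    \<beta> N^d.\<close>
  define c1 where "c1 = \<beta> * m / (4 * G)"
  define c2 where "c2 = 2 * \<beta> * F / G"
  define b where "b t = 1 - exp (- (exp (- (4 * c2)) / exp (ln t / 4)) * (sqrt t / 2))" for t
  have \<kappa>: "\<kappa> > 0" and G: "G > 0" and c1: "c1 > 0" and d: "real d > 0"
    using d_pos m beta_pos by (auto simp: \<kappa>_def G_def c1_def)
  interpret P: prob_space "phase_distr d f" by (rule prob_space_phase_distr[OF f_meas f_int])
  have b_lim: "(b \<longlongrightarrow> 1) at_top"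
  proof -
    have "exp (- (4 * c2)) > 0" by simp
    then show ?thesis unfolding b_def by real_asymp
  qed
  show ?thesis
  \<comment> \<open>The divisor 4 comes from the Rayleigh bound k/4; the constant depends on
    \<open>d\<close> only.\<close>
  proof (intro exI[of _ "\<kappa> / 4"] conjI allI impI)
    show "\<kappa> / 4 > 0" using \<kappa> by simp
    fix N L :: "nat \<Rightarrow> nat"
    assume N: "filterlim N at_top sequentially" and L: "filterlim L at_top sequentially"
      and ratio: "(\<lambda>n. real (L n) / real (N n) ^ d) \<longlonglongrightarrow> \<beta>"
    let ?P = "\<lambda>n. measure (phases_distr d f (L n))
         {x \<in> space (phases_distr d f (L n)).
            largest_eigenvalue (mat_adjoint (vandermonde_d d (N n) (L n) x) * vandermonde_d d (N n) (L n) x)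
            \<ge> \<kappa> / 4 * ln (real (N n) ^ d) / ln (ln (real (N n) ^ d))}"
    have realN: "filterlim (\<lambda>n. real (N n)) at_top sequentially"
      by (rule filterlim_compose[OF filterlim_real_sequentially N])
    note grid = eventually_compose_filterlim[OF
        eventually_grid_asymptotics[OF \<kappa> d G beta_pos c1 F] realN]
    have lower: "\<forall>\<^sub>F n in sequentially. \<beta> / 2 < real (L n) / real (N n) ^ d"
      using beta_pos by (intro order_tendstoD(1)[OF ratio]) simp
    have upper: "\<forall>\<^sub>F n in sequentially. real (L n) / real (N n) ^ d < 2 * \<beta>"
      using beta_pos by (intro order_tendstoD(2)[OF ratio]) simp
    have main: "\<forall>\<^sub>F n in sequentially. b (real (N n)) \<le> ?P n"
      using grid lower upper
    proof eventually_elim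
      case (elim n)
      define t where "t = real (N n)"
      define u where "u = real d * ln t"
      define k where "k = nat \<lceil>\<kappa> * u / ln u\<rceil>"
      define J where "J = nat \<lfloor>sqrt t\<rfloor>"
      \<comment> \<open>A reserve of balls that is free at every stage. At most a quarter of \<beta>
        N^d is used up out of at least half of it, so the subtraction does not truncate and at least
        a quarter remains.\<close>
      define n0 where "n0 = L n - k * J"
      define p0 where "p0 = m * (1 / (6 * real d * real (N n))) ^ d"
      define p1 where "p1 = F * (1 / (6 * real d * real (N n))) ^ d"
      from elim have t: "16 \<le> t" and lnu: "1 \<le> ln u"
        and k_le: "\<kappa> * u / ln u + 1 \<le> 2 * \<kappa> * u / ln u" "\<kappa> * u / ln u + 1 \<le> c1 * u\<^sup>2"
          "(\<kappa> * u / ln u + 1) * sqrt t \<le> \<beta> / 4 * t" "\<kappa> * u / ln u + 1 \<le> \<beta> / 4 * t"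
        and p1_le: "F / (G * t) \<le> 1 / 4" "2 * (sqrt t * (F / (G * t))) \<le> 1"
        and L_ge: "\<beta> / 2 < real (L n) / t ^ d" and L_le: "real (L n) / t ^ d < 2 * \<beta>"
        unfolding t_def[symmetric] u_def[symmetric] by blast+
      have u: "u > 0" unfolding u_def using d t by simp
      have ln_pow: "ln (t ^ d) = u" unfolding u_def using t by (simp add: ln_realpow)
      have td: "t \<le> t ^ d" "0 < t ^ d"
        using t d_pos self_le_power[of t d] by auto
      have kpos: "0 < \<kappa> * u / ln u" using \<kappa> u lnu by (intro divide_pos_pos mult_pos_pos) linarith+
      then have k: "k > 0" "\<kappa> * u / ln u \<le> real k" "real k \<le> \<kappa> * u / ln u + 1"
        unfolding k_def by linarith+
      have sqrt_t: "4 \<le> sqrt t" "sqrt t \<le> t"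
        using t real_sqrt_le_mono[of 16 t] by (auto simp: sqrt_le_D real_le_lsqrt power2_eq_square)
      \<comment> \<open>As sqrt t \<ge> 4, rounding down loses at most half.\<close>
      then have J: "J > 0" "real J \<le> sqrt t" "sqrt t / 2 \<le> real J"
        unfolding J_def by linarith+
      have JN: "J \<le> N n" using J(2) sqrt_t(2) by (simp add: t_def)
      \<comment> \<open>The asymptotic estimates are in terms of \<open>t\<close>; they carry over
        because t \<le> t^d.\<close>
      have td': "\<beta> / 4 * t \<le> \<beta> / 4 * t ^ d"
        using td(1) beta_pos by (intro mult_left_mono) auto
      have "real k * real J \<le> (\<kappa> * u / ln u + 1) * sqrt t"
        using k J kpos by (intro mult_mono) auto
      then have kJ: "real (k * J) \<le> \<beta> / 4 * t ^ d"
        using k_le(3) td' unfolding of_nat_mult by linarith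
      have L': "\<beta> / 2 * t ^ d \<le> real (L n)" "real (L n) \<le> 2 * \<beta> * t ^ d"
        using L_ge L_le td(2) by (auto simp: pos_less_divide_eq pos_divide_less_eq)
      have "\<beta> / 4 * t ^ d \<le> \<beta> / 2 * t ^ d"
        using beta_pos td(2) by (intro mult_right_mono) auto
      then have "real (k * J) \<le> real (L n)" using kJ L'(1) by linarith
      then have kJL: "k * J \<le> L n" by linarith
      then have n0: "\<beta> / 4 * t ^ d \<le> real n0"
        using kJ L'(1) unfolding n0_def of_nat_diff[OF kJL] by linarith
      have kn0: "k \<le> n0"
        using n0 k(3) k_le(4) td' by linarith
      have cube: "(1 / (6 * real d * real (N n))) ^ d = 1 / (G * t ^ d)"
        by (simp add: G_def t_def power_divide power_mult_distrib)
      have p1_le': "p1 \<le> F / (G * t)"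
        unfolding p1_def cube using F G t td by (simp add: divide_left_mono)
      have p1_nonneg: "0 \<le> p1" unfolding p1_def using F by simp
      have "sqrt t * p1 \<le> sqrt t * (F / (G * t))" using p1_le' t by (intro mult_left_mono) auto
      moreover have "real J * p1 \<le> sqrt t * p1" using J(2) p1_nonneg by (rule mult_right_mono)
      ultimately have Jp1: "2 * (real J * p1) \<le> 1" using p1_le(2) by linarith
      have hit: "exp (- (4 * c2)) / exp (ln t / 4) \<le> real (n0 choose k) * p0 ^ k * (1 - 2 * p1) ^ L n"
      proof (rule bin_hit_probability_ge[OF k(1) kn0 c1 _ _ p1_nonneg])
        have "c1 = \<beta> / 4 * t ^ d * p0"
          unfolding p0_def cube c1_def using t G by (simp add: field_simps)
        also have "\<dots> \<le> real n0 * p0"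
          using n0 m by (intro mult_right_mono) (auto simp: p0_def)
        finally show "c1 \<le> real n0 * p0" .
        have "(real k / c1) ^ k \<le> exp (4 * \<kappa> * u)"
          using k k_le by (intro power_le_exp_of_log[OF _ c1 u lnu]) auto
        also have "4 * \<kappa> * u = ln t / 4" using d by (simp add: \<kappa>_def u_def)
        finally show "(real k / c1) ^ k \<le> exp (ln t / 4)" .
        show "4 * p1 \<le> 1" using p1_le(1) p1_le' by linarith
        have "p1 * real (L n) \<le> p1 * (2 * \<beta> * t ^ d)"
          using L'(2) p1_nonneg by (rule mult_left_mono)
        also have "\<dots> = c2"
          unfolding p1_def cube c2_def using t G by (simp add: field_simps)
        finally show "p1 * real (L n) \<le> c2" .
      qed
      have "exp (- (4 * c2)) / exp (ln t / 4) * (sqrt t / 2)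
          \<le> real (n0 choose k) * p0 ^ k * (1 - 2 * p1) ^ L n * real J"
        using J(3) t by (intro mult_mono order_trans[OF _ hit] hit) auto
      then have "b t \<le> 1 - exp (- (real (n0 choose k) * p0 ^ k * (1 - 2 * p1) ^ L n) * real J)"
        unfolding b_def by simp
      also have "\<dots> \<le> ?P n"
        unfolding p0_def p1_def
      proof (rule prob_largest_eigenvalue_ge[OF _ _ _ k(1) J(1) JN f_meas f_int _ _ bounds])
        show "\<kappa> / 4 * ln (real (N n) ^ d) / ln (ln (real (N n) ^ d)) \<le> real k / 4"
          using k(2) by (simp add: ln_pow flip: t_def)
        show "0 < N n" using t by (simp add: t_def)
        show "0 < L n" using kn0 k(1) by (simp add: n0_def)
        show "2 * (F * (1 / (6 * real d * real (N n))) ^ d) \<le> 1"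
          unfolding p1_def[symmetric] using p1_le(1) p1_le' p1_nonneg by linarith
        show "2 * (real J * (F * (1 / (6 * real d * real (N n))) ^ d)) \<le> 1"
          using Jp1 unfolding p1_def .
        show "n0 + k * J \<le> L n" using kJL by (simp add: n0_def)
      qed (use d_pos m F in auto)
      finally show ?case by (simp add: t_def)
    qed
    have "?P n \<le> 1" for n
      unfolding phases_distr_def
      by (intro prob_space.prob_le_1 prob_space_PiM P.prob_space_axioms)
    then show "?P \<longlonglongrightarrow> 1"
      by (intro tendsto_sandwich[OF main _ filterlim_compose[OF b_lim realN] tendsto_const]) simp
  qed
qed

end
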